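(* Let $n\ge 0$ be an integer. There is a parity reversing involution $\phi$ on the set of improper colored binary trees with $n$ internal vertices; that is, there is a map $\phi$ from this set to itself such that $\phi(\phi(B))=B$ and the color numbers $c(\phi(B))$ and $c(B)$ have opposite parity for every improper colored binary tree $B$ with $n$ internal vertices. Furthermore, $$|\mathcal{ECB}_n|-|\mathcal{OCB}_n|=|\mathcal{CB}'_{n}|.$$
   Context: A complete binary tree is a rooted plane tree in which every internal vertex has exactly two children, a left child and a right child; the other vertices are leaves, and the tree consisting of a single leaf has $0$ internal vertices. Let $\mathcal{B}_n$ be the set of complete binary trees with $n$ internal vertices. Let $B\in\mathcal{B}_n$. A path $P=v_0v_1\cdots v_k$ of length $k\ge 0$ in $B$ (going away from the root, and possibly ending at a leaf) is an L-path if $v_i$ is the left child of $v_{i-1}$ for all $1\le i\le k$. It is a maximal L-path if there is no vertex $u$ such that $uP$ or $Pu$ is an L-path. If $P=v_0v_1\cdots v_k$ is a maximal L-path, then $v_0$ is called an initial vertex of $B$, and $P$ is its associate path; $l(v_0)=k$ denotes the length (number of edges) of this path. Thus the initial vertices are exactly the root and all right children, including leaves that are right children, for which $l=0$. A colored binary tree is a complete binary tree in which each initial vertex $v$ is assigned an integer color $c(v)$ with $0\le c(v)\le \lfloor l(v)/2\rfloor$. The color number $c(B)$ of a colored binary tree $B$ is the sum of the colors of all its initial vertices. An initial vertex $v$ of a colored binary tree is proper if, for some integer $k\ge 0$, $c(v)=2k$ and $l(v)\in\{4k,4k+1\}$; otherwise it is improper. A colored binary tree is proper if all its initial vertices are proper,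 and improper otherwise. $\mathcal{CB}'_n$ is the set of all proper colored binary trees with $n$ internal vertices. $\mathcal{ECB}_n$ (respectively $\mathcal{OCB}_n$) is the set of all colored binary trees with $n$ internal vertices (proper or improper) whose color number is even (respectively odd). *)

theory Defs
  imports "HOL-Library.Tree" "HOL-Library.FuncSet"
begin

text \<open>
  A complete binary tree is an element of \<^typ>\<open>unit tree\<close>; \<^term>\<open>size B\<close> counts its
  internal vertices.  A vertex is addressed by the sequence of child directions leading to it from
  the root, so the root is \<^term>\<open>[]\<close> and the left child of \<open>v\<close> is \<open>v @ [Left]\<close>.
\<close>

datatype dir = Left | Right

type_synonym vertex = "dir list"

definition binary_trees :: "nat \<Rightarrow> unit tree set" where
  "binary_trees n = {B. size B = n}"

fun vertices :: "unit tree \<Rightarrow> vertex set" where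
  "vertices Leaf = {[]}"
| "vertices (Node t1 _ t2) = {[]} \<union> Cons Left ` vertices t1 \<union> Cons Right ` vertices t2"

definition L_path :: "unit tree \<Rightarrow> vertex list \<Rightarrow> bool" where
  "L_path B P \<longleftrightarrow>
     P \<noteq> [] \<and> set P \<subseteq> vertices B \<and> (\<forall>i. Suc i < length P \<longrightarrow> P ! Suc i = P ! i @ [Left])"

definition maximal_L_path :: "unit tree \<Rightarrow> vertex list \<Rightarrow> bool" where
  "maximal_L_path B P \<longleftrightarrow>
     L_path B P \<and> \<not> (\<exists>u \<in> vertices B. L_path B (u # P) \<or> L_path B (P @ [u]))"

definition initial_vertices :: "unit tree \<Rightarrow> vertex set" where
  "initial_vertices B = {v. \<exists>P. maximal_L_path B P \<and> hd P = v}"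

text \<open>The path length counts edges; the maximal L-path starting at an initial vertex is unique.\<close>

definition path_length :: "unit tree \<Rightarrow> vertex \<Rightarrow> nat" where
  "path_length B v = length (THE P. maximal_L_path B P \<and> hd P = v) - 1"

text \<open>
  A coloring is an extensional function on the initial vertices (it is \<^const>\<open>undefined\<close>
  elsewhere), so that distinct pairs are distinct colored binary trees.
\<close>

type_synonym colored_tree = "unit tree \<times> (vertex \<Rightarrow> nat)"

definition colored_trees :: "nat \<Rightarrow> colored_tree set" where
  "colored_trees n =
     (SIGMA B : binary_trees n. \<Pi>\<^sub>E v \<in> initial_vertices B. {0..path_length B v div 2})"

definition color_number :: "colored_tree \<Rightarrow> nat" where
  "color_number = (\<lambda>(B, c). \<Sum>v \<in> initial_vertices B. c v)"

definition proper_vertex :: "colored_tree \<Rightarrow> vertex \<Rightarrow> bool" where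
  "proper_vertex = (\<lambda>(B, c) v. \<exists>k. c v = 2 * k \<and> path_length B v \<in> {4 * k, 4 * k + 1})"

definition proper :: "colored_tree \<Rightarrow> bool" where
  "proper C \<longleftrightarrow> (\<forall>v \<in> initial_vertices (fst C). proper_vertex C v)"

definition proper_colored_trees :: "nat \<Rightarrow> colored_tree set" where
  "proper_colored_trees n = {C \<in> colored_trees n. proper C}"

definition improper_colored_trees :: "nat \<Rightarrow> colored_tree set" where
  "improper_colored_trees n = {C \<in> colored_trees n. \<not> proper C}"

definition even_colored_trees :: "nat \<Rightarrow> colored_tree set" where
  "even_colored_trees n = {C \<in> colored_trees n. even (color_number C)}"

definition odd_colored_trees :: "nat \<Rightarrow> colored_tree set" where
  "odd_colored_trees n = {C \<in> colored_trees n. odd (color_number C)}"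

end

(* Write m v for the floor of l(v)/2. A vertex is proper iff m v is even and c(v) = m v, so the
   colors that make v improper split into the pairs {2j, 2j+1} with 2j+1 \<le> m v. Flipping the color
   of one improper vertex inside its pair changes the parity of the color number and leaves the tree
   and the set of improper vertices unchanged. It is an involution if the flipped vertex is
   chosen as a function of the tree and this set alone. *)

theory Submission
  imports Defs
begin

definition flip :: "nat \<Rightarrow> nat" where
  "flip k = (if even k then Suc k else k - 1)"

lemma flip_flip [simp]: "flip (flip k) = k"
  by (simp add: flip_def)

lemma even_flip [simp]: "even (flip k) \<longleftrightarrow> odd k"
  by (auto simp: flip_def)

text \<open>\<open>flip\<close> raises only even numbers. An even \<open>k\<close> is different from
  \<open>m\<close> by the second assumption, so \<open>Suc k\<close> still fits below
  \<open>m\<close>.\<close>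

lemma flip_le:
  assumes "k \<le> m" "\<not> (even m \<and> k = m)"
  shows "flip k \<le> m"
  using assms by (cases "k = m") (auto simp: flip_def)

text \<open>Only the odd number \<open>Suc m\<close> is flipped to an even \<open>m\<close>, and it
  exceeds the bound. Hence a flip never produces the one proper color.\<close>

lemma flip_eq_even_bound:
  assumes "k \<le> m" "even m"
  shows "flip k \<noteq> m"
  using assms by (auto simp: flip_def elim: oddE)

lemma proper_vertex_iff:
  "proper_vertex (B, c) v \<longleftrightarrow> even (path_length B v div 2) \<and> c v = path_length B v div 2"
proof -
  \<comment> \<open>Halving absorbs the two cases, so \<open>k\<close> is determined by the path
    length and the existential quantifier disappears.\<close>
  have "l \<in> {4 * k, 4 * k + 1} \<longleftrightarrow> l div 2 = 2 * k" for l k :: nat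
    by (simp only: insert_iff empty_iff) presburger
  then show ?thesis
    by (auto simp: proper_vertex_def simp del: insert_iff elim!: evenE)
qed

lemma finite_vertices: "finite (vertices B)"
  by (induction B) auto

lemma finite_initial_vertices: "finite (initial_vertices B)"
proof (rule finite_subset[OF _ finite_vertices])
  show "initial_vertices B \<subseteq> vertices B"
    by (auto simp: initial_vertices_def maximal_L_path_def L_path_def)
qed

lemma finite_binary_trees: "finite (binary_trees n)"
proof (induction n rule: less_induct)
  case (less n)
  let ?S = "\<Union>i<n. binary_trees i"
  have "binary_trees n \<subseteq> insert Leaf ((\<lambda>(l, r). Node l () r) ` (?S \<times> ?S))"
  proof
    fix B :: "unit tree"
    assume B: "B \<in> binary_trees n"
    show "B \<in> insert Leaf ((\<lambda>(l, r). Node l () r) ` (?S \<times> ?S))"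
      using B by (cases B) (auto simp: binary_trees_def image_iff)
  qed
  moreover have "finite ?S"
    using less by blast
  ultimately show ?case
    by (meson finite.insertI finite_SigmaI finite_imageI finite_subset)
qed

text \<open>The final count adds cardinalities of disjoint sets, which is valid only for finite
  sets.\<close>

lemma finite_colored_trees: "finite (colored_trees n)"
  unfolding colored_trees_def
  by (intro finite_SigmaI finite_binary_trees finite_PiE finite_initial_vertices) auto

definition improper_vertices :: "colored_tree \<Rightarrow> vertex set" where
  "improper_vertices C = {v \<in> initial_vertices (fst C). \<not> proper_vertex C v}"

definition flip_at :: "vertex \<Rightarrow> colored_tree \<Rightarrow> colored_tree" where
  "flip_at v = (\<lambda>(B, c). (B, c(v := flip (c v))))"

lemma flip_at_flip_at [simp]: "flip_at v (flip_at v C) = C"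
  by (simp add: flip_at_def split: prod.split)

lemma flip_at_colored_trees:
  assumes "C \<in> colored_trees n" "v \<in> improper_vertices C"
  shows "flip_at v C \<in> colored_trees n"
proof -
  obtain B c where C: "C = (B, c)"
    by (cases C)
  have "flip (c v) \<le> path_length B v div 2"
    using assms by (intro flip_le) (auto simp: C colored_trees_def improper_vertices_def proper_vertex_iff)
  then show ?thesis
    using assms
    by (auto simp: C colored_trees_def improper_vertices_def flip_at_def PiE_iff extensional_def)
qed

text \<open>The tree stays the same and the color changes only at \<open>v\<close>, which remains
  improper because its new color misses an even bound.\<close>

lemma improper_vertices_flip_at:
  assumes "C \<in> colored_trees n" "v \<in> improper_vertices C"
  shows "improper_vertices (flip_at v C) = improper_vertices C"
proof -
  obtain B c where C: "C = (B, c)"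
    by (cases C)
  have le: "c v \<le> path_length B v div 2"
    using assms by (auto simp: C colored_trees_def improper_vertices_def)
  show ?thesis
    using assms(2) flip_eq_even_bound[OF le]
    by (auto simp: C improper_vertices_def flip_at_def proper_vertex_iff)
qed

text \<open>Splitting off the summand at \<open>v\<close> leaves a sum that the flip does not touch,
  and the split summand changes parity.\<close>

lemma even_color_number_flip_at:
  assumes "v \<in> initial_vertices (fst C)"
  shows "even (color_number (flip_at v C)) \<longleftrightarrow> odd (color_number C)"
proof -
  obtain B c where C: "C = (B, c)"
    by (cases C)
  have v: "v \<in> initial_vertices B"
    using assms by (simp add: C)
  have "(\<Sum>w \<in> initial_vertices B - {v}. (c(v := flip (c v))) w) =
        (\<Sum>w \<in> initial_vertices B - {v}. c w)"
    by (intro sum.cong) auto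
  then show ?thesis
    by (auto simp: C color_number_def flip_at_def sum.remove[OF finite_initial_vertices v])
qed

text \<open>The choice operator is applied to a predicate that depends only on the set of improper
  vertices, so trees with equal sets get the same vertex.\<close>

definition parity_involution :: "colored_tree \<Rightarrow> colored_tree" where
  "parity_involution C = flip_at (SOME v. v \<in> improper_vertices C) C"

lemma improper_colored_trees_iff:
  "C \<in> improper_colored_trees n \<longleftrightarrow> C \<in> colored_trees n \<and> improper_vertices C \<noteq> {}"
  by (auto simp: improper_colored_trees_def proper_def improper_vertices_def)

lemma
  assumes "C \<in> improper_colored_trees n"
  shows parity_involution_closed: "parity_involution C \<in> improper_colored_trees n"
    and parity_involution_involutive: "parity_involution (parity_involution C) = C"
    and even_color_number_parity_involution:
      "even (color_number (parity_involution C)) \<longleftrightarrow> odd (color_number C)"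
proof -
  let ?v = "SOME v. v \<in> improper_vertices C"
  have C: "C \<in> colored_trees n" and v: "?v \<in> improper_vertices C"
    using assms by (auto simp: improper_colored_trees_iff some_in_eq)
  note same = improper_vertices_flip_at[OF C v]
  show "parity_involution C \<in> improper_colored_trees n"
    using flip_at_colored_trees[OF C v] same v
    by (auto simp: improper_colored_trees_iff parity_involution_def)
  \<comment> \<open>By \<open>same\<close>, the second application chooses \<open>?v\<close> again,
    and the two flips cancel.\<close>
  show "parity_involution (parity_involution C) = C"
    by (simp add: parity_involution_def same)
  show "even (color_number (parity_involution C)) \<longleftrightarrow> odd (color_number C)"
    using v by (simp add: parity_involution_def even_color_number_flip_at improper_vertices_def)
qed

text \<open>Every color of a proper tree equals an even bound, so the color number is a sum of even
  numbers.\<close>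

lemma proper_imp_even_color_number:
  assumes "proper C"
  shows "even (color_number C)"
  using assms
  by (cases C) (auto simp: proper_def color_number_def proper_vertex_iff intro!: dvd_sum)

theorem theorem1:
  fixes n :: nat
  shows "(\<exists>\<phi> \<in> improper_colored_trees n \<rightarrow> improper_colored_trees n.
            \<forall>C \<in> improper_colored_trees n.
              \<phi> (\<phi> C) = C \<and> even (color_number (\<phi> C)) \<noteq> even (color_number C)) \<and>
         int (card (even_colored_trees n)) - int (card (odd_colored_trees n)) =
           int (card (proper_colored_trees n))"
proof
  show "\<exists>\<phi> \<in> improper_colored_trees n \<rightarrow> improper_colored_trees n.
          \<forall>C \<in> improper_colored_trees n.
            \<phi> (\<phi> C) = C \<and> even (color_number (\<phi> C)) \<noteq> even (color_number C)"
    using parity_involution_closed parity_involution_involutive even_color_number_parity_involution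
    by (intro bexI[of _ parity_involution]) auto
  let ?I = "improper_colored_trees n"
  \<comment> \<open>The map is its own inverse and exchanges the two parity classes of improper
    trees.\<close>
  have "bij_betw parity_involution {C \<in> ?I. even (color_number C)} {C \<in> ?I. odd (color_number C)}"
    by (rule bij_betw_byWitness[where f' = parity_involution])
      (auto simp: parity_involution_closed parity_involution_involutive
        even_color_number_parity_involution)
  moreover have "{C \<in> ?I. odd (color_number C)} = odd_colored_trees n"
    using proper_imp_even_color_number
    by (auto simp: improper_colored_trees_def odd_colored_trees_def)
  ultimately have "card {C \<in> ?I. even (color_number C)} = card (odd_colored_trees n)"
    by (simp add: bij_betw_same_card)
  \<comment> \<open>The even improper trees are as many as the odd trees, so the difference leaves
    just the proper ones.\<close>
  moreover have "even_colored_trees n = proper_colored_trees n \<union> {C \<in> ?I. even (color_number C)}"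
    using proper_imp_even_color_number
    by (auto simp: improper_colored_trees_def even_colored_trees_def proper_colored_trees_def)
  moreover have "finite (proper_colored_trees n)" "finite {C \<in> ?I. even (color_number C)}"
    using finite_colored_trees[of n]
    by (auto simp: improper_colored_trees_def proper_colored_trees_def)
  moreover have "proper_colored_trees n \<inter> {C \<in> ?I. even (color_number C)} = {}"
    by (auto simp: improper_colored_trees_def proper_colored_trees_def)
  ultimately show "int (card (even_colored_trees n)) - int (card (odd_colored_trees n)) =
      int (card (proper_colored_trees n))"
    by (simp add: card_Un_disjoint)
qed

end
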